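(* For all positive integers $m,n$, the separated priority queue number of the complete bipartite graph $K_{m,n}$ satisfies $\operatorname{bpqn}(K_{m,n})=\min\{m,n\}$.
   Context: All graphs are finite, simple and undirected. An edge-weighted graph $\langle G,w\rangle$ is a graph $G=(V,E)$ with $w\colon E\to\mathbb{R}$. A PQ-layout of $\langle G,w\rangle$ with $k$ priority queues consists of a linear ordering $\prec$ of $V$ and a partition of $E$ into $k$ sets $\mathcal{P}_1,\dots,\mathcal{P}_k$ such that there is no $i$ and no two edges $e=uv$, $e'=u'v'$ in $\mathcal{P}_i$ with $w(e)>w(e')$ and $u\prec v$, $u'\prec v$, $v\prec v'$. For a bipartite graph $G$ with bipartition classes $A$ and $B$, a PQ-layout is separated if in $\prec$ all vertices of $A$ precede all vertices of $B$ or all vertices of $B$ precede all vertices of $A$. The separated priority queue number $\operatorname{bpqn}(G)$ is the minimum integer $k$ such that for every edge-weight function $w\colon E\to\mathbb{R}$ there is a separated PQ-layout of $\langle G,w\rangle$ with $k$ priority queues. *)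

theory Defs
  imports Complex_Main "HOL-Library.Disjoint_Sets"
begin

type_synonym 'a graph = "'a set \<times> 'a set set"

abbreviation verts :: "'a graph \<Rightarrow> 'a set" where "verts \<equiv> fst"
abbreviation edges :: "'a graph \<Rightarrow> 'a set set" where "edges \<equiv> snd"

definition simple_graph :: "'a graph \<Rightarrow> bool" where
  "simple_graph G \<longleftrightarrow> finite (verts G) \<and> (\<forall>e\<in>edges G. e \<subseteq> verts G \<and> card e = 2)"

definition bipartition :: "'a graph \<Rightarrow> 'a set \<Rightarrow> 'a set \<Rightarrow> bool" where
  "bipartition G A B \<longleftrightarrow>
     A \<union> B = verts G \<and> A \<inter> B = {} \<and> (\<forall>e\<in>edges G. \<exists>a\<in>A. \<exists>b\<in>B. e = {a, b})"

text \<open>The pair \<open>(u, v) \<in> r\<close> means that \<open>u\<close> strictly precedes \<open>v\<close>. The sets \<open>P 1, \<dots>, P k\<close>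
  may be empty. Only the values of \<open>w\<close> on the edges of \<open>G\<close> are relevant.\<close>

definition pq_layout ::
    "'a graph \<Rightarrow> ('a set \<Rightarrow> real) \<Rightarrow> nat \<Rightarrow> 'a rel \<Rightarrow> (nat \<Rightarrow> 'a set set) \<Rightarrow> bool" where
  "pq_layout G w k r P \<longleftrightarrow>
     r \<subseteq> verts G \<times> verts G \<and> strict_linear_order_on (verts G) r \<and>
     disjoint_family_on P {1..k} \<and> (\<Union>i\<in>{1..k}. P i) = edges G \<and>
     \<not> (\<exists>i\<in>{1..k}. \<exists>u v u' v'. {u, v} \<in> P i \<and> {u', v'} \<in> P i \<and>
          w {u, v} > w {u', v'} \<and> (u, v) \<in> r \<and> (u', v) \<in> r \<and> (v, v') \<in> r)"

definition separated :: "'a rel \<Rightarrow> 'a set \<Rightarrow> 'a set \<Rightarrow> bool" where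
  "separated r A B \<longleftrightarrow> (\<forall>a\<in>A. \<forall>b\<in>B. (a, b) \<in> r) \<or> (\<forall>a\<in>A. \<forall>b\<in>B. (b, a) \<in> r)"

text \<open>Meant for a simple graph \<open>G\<close> with bipartition classes \<open>A\<close> and \<open>B\<close>; the classes are arguments
  because a disconnected graph does not determine them. The minimum exists, since one
  queue per edge always suffices.\<close>

definition bpqn :: "'a graph \<Rightarrow> 'a set \<Rightarrow> 'a set \<Rightarrow> nat" where
  "bpqn G A B =
     (LEAST k. \<forall>w :: 'a set \<Rightarrow> real. \<exists>r P. pq_layout G w k r P \<and> separated r A B)"

definition left_class :: "nat \<Rightarrow> (nat + nat) set" where
  "left_class m = Inl ` {..<m}"

definition right_class :: "nat \<Rightarrow> (nat + nat) set" where
  "right_class n = Inr ` {..<n}"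

definition complete_bipartite :: "nat \<Rightarrow> nat \<Rightarrow> (nat + nat) graph" where
  "complete_bipartite m n =
     (left_class m \<union> right_class n, {{a, b} | a b. a \<in> left_class m \<and> b \<in> right_class n})"

lemma simple_graph_complete_bipartite: "simple_graph (complete_bipartite m n)"
  by (auto simp: simple_graph_def complete_bipartite_def left_class_def right_class_def)

lemma bipartition_complete_bipartite:
  "bipartition (complete_bipartite m n) (left_class m) (right_class n)"
  by (auto simp: bipartition_def complete_bipartite_def left_class_def right_class_def)

lemma card_left_class: "card (left_class m) = m"
  by (simp add: left_class_def card_image)

lemma card_right_class: "card (right_class n) = n"
  by (simp add: right_class_def card_image)

end

theory Submission
  imports Defs
begin

text \<open>In a separated layout, two edges that meet in the later class never violate the queue
  condition, so the stars at the vertices of the later class can serve as the queues. Conversely,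
  give the edge between the \<open>i\<close>-th left and the \<open>j\<close>-th right vertex the weight \<open>(i + j) mod s\<close>,
  where \<open>s = min m n\<close>. Among the first \<open>s\<close> vertices of each class this is a Latin square, so
  for every order of the later class one can pick one edge at each of its first \<open>s\<close> vertices such
  that the weights strictly decrease along the order. These \<open>s\<close> edges lie in distinct queues.\<close>

lemma bipartition_commute: "bipartition G A B \<Longrightarrow> bipartition G B A"
  unfolding bipartition_def by (metis Int_commute Un_commute insert_commute)

lemma separated_commute: "separated r A B \<longleftrightarrow> separated r B A"
  unfolding separated_def by blast

lemma pq_layout_stars:
  assumes bip: "bipartition G X Y" and fin: "finite X" "finite Y"
  shows "\<exists>r P. pq_layout G w (card Y) r P \<and> separated r X Y"
proof -
  obtain f where f: "bij_betw f X {0..<card X}"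
    using ex_bij_betw_finite_nat[OF fin(1)] by blast
  obtain g where g: "bij_betw g Y {0..<card Y}"
    using ex_bij_betw_finite_nat[OF fin(2)] by blast
  \<comment> \<open>Shifting \<open>g\<close> by \<open>card X\<close> puts every vertex of
    \<open>Y\<close> after every vertex of \<open>X\<close>. Since \<open>h\<close> is injective,
    pulling back \<open><\<close> along it gives a strict linear order.\<close>
  define h where "h v = (if v \<in> X then f v else card X + g v)" for v
  define r where "r = {(u, v). u \<in> verts G \<and> v \<in> verts G \<and> h u < h v}"
  \<comment> \<open>\<open>Suc\<close> is there because \<open>g\<close> counts from 0 but queues
    are numbered from 1.\<close>
  define P where "P i = {e \<in> edges G. \<exists>y\<in>Y. y \<in> e \<and> Suc (g y) = i}" for i
  have V: "verts G = X \<union> Y" and disj: "X \<inter> Y = {}"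
    and E: "\<And>e. e \<in> edges G \<Longrightarrow> \<exists>x\<in>X. \<exists>y\<in>Y. e = {x, y}"
    using bip by (auto simp: bipartition_def)
  have fX: "f x < card X" if "x \<in> X" for x
    using f that by (auto simp: bij_betw_def)
  have gY: "g y < card Y" if "y \<in> Y" for y
    using g that by (auto simp: bij_betw_def)
  have g_inj: "y = y'" if "y \<in> Y" "y' \<in> Y" "g y = g y'" for y y'
    using g that by (auto simp: bij_betw_def inj_on_def)
  have hX: "h x = f x" if "x \<in> X" for x using that by (simp add: h_def)
  have hY: "h y = card X + g y" if "y \<in> Y" for y using that disj by (auto simp: h_def)
  have XY: "h x < h y" if "x \<in> X" "y \<in> Y" for x y
    using that fX[of x] by (simp add: hX hY)
  have h_inj: "inj_on h (X \<union> Y)"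
  proof -
    have "inj_on h X" "inj_on h Y"
      using f g by (auto simp: bij_betw_def inj_on_def hX hY)
    moreover have "h ` X \<inter> h ` Y = {}"
      using XY by force
    ultimately show ?thesis
      by (auto simp: inj_on_Un)
  qed
  have lin: "strict_linear_order_on (verts G) r"
    using inj_onD[OF h_inj] unfolding strict_linear_order_on_def r_def V
    by (force simp: trans_def irrefl_def total_on_def neq_iff)
  have one_end: "y = y'" if "e \<in> edges G" "y \<in> Y" "y' \<in> Y" "y \<in> e" "y' \<in> e" for e y y'
    using E[OF that(1)] that disj by auto
  have "disjoint_family_on P {1..card Y}"
    unfolding disjoint_family_on_def P_def using one_end by blast
  moreover have "(\<Union>i\<in>{1..card Y}. P i) = edges G"
  proof
    show "(\<Union>i\<in>{1..card Y}. P i) \<subseteq> edges G" by (auto simp: P_def)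
    show "edges G \<subseteq> (\<Union>i\<in>{1..card Y}. P i)"
    proof
      fix e assume e: "e \<in> edges G"
      then obtain y where "y \<in> Y" "y \<in> e" using E by blast
      then have "e \<in> P (Suc (g y))" "Suc (g y) \<in> {1..card Y}"
        using e gY[of y] by (auto simp: P_def)
      then show "e \<in> (\<Union>i\<in>{1..card Y}. P i)" by blast
    qed
  qed
  \<comment> \<open>In a violation, \<open>v\<close> and \<open>v'\<close> are the later ends of two
    edges of one queue, as \<open>u'\<close> precedes \<open>v\<close> and \<open>v\<close> precedes
    \<open>v'\<close>. Later ends lie in \<open>Y\<close>, and the queue index determines the end in
    \<open>Y\<close>, so \<open>v = v'\<close>, which contradicts irreflexivity.\<close>
  moreover have False
    if "{u, v} \<in> P i" "{u', v'} \<in> P i" "(u, v) \<in> r" "(u', v) \<in> r" "(v, v') \<in> r"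
    for i u v u' v'
  proof -
    have late_end: "b \<in> Y \<and> Suc (g b) = i" if "{a, b} \<in> P i" "h a < h b" for a b
    proof -
      from that(1) obtain y where y: "y \<in> Y" "y \<in> {a, b}" "Suc (g y) = i" "{a, b} \<in> edges G"
        by (auto simp: P_def)
      obtain x z where "x \<in> X" "z \<in> Y" "{a, b} = {x, z}" using E y(4) by blast
      with XY[of x z] that(2) have "b \<in> Y" by (auto simp: doubleton_eq_iff)
      then show ?thesis using one_end[OF y(4), of b y] y by auto
    qed
    have "v \<in> Y \<and> Suc (g v) = i" "v' \<in> Y \<and> Suc (g v') = i"
      using that late_end[of u v] late_end[of u' v'] by (auto simp: r_def)
    then have "v = v'" using g_inj by auto
    then show False using that(5) by (simp add: r_def)
  qed
  moreover have "r \<subseteq> verts G \<times> verts G" by (auto simp: r_def)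
  ultimately have "pq_layout G w (card Y) r P"
    unfolding pq_layout_def using lin by blast
  moreover have "separated r X Y"
    using XY by (auto simp: separated_def r_def V)
  ultimately show ?thesis by blast
qed

text \<open>Isolates what the lower bound needs from the weights, so that it applies to either class
  being later. \<open>X\<close> and \<open>Y\<close> may be proper subsets of the classes.\<close>

lemma card_later_class_le_queues:
  assumes layout: "pq_layout G w k r P"
    and before: "\<And>x y. x \<in> X \<Longrightarrow> y \<in> Y \<Longrightarrow> (x, y) \<in> r"
    and fin: "finite Y" and Y_verts: "Y \<subseteq> verts G"
    and weights: "\<And>y t. y \<in> Y \<Longrightarrow> t < card Y \<Longrightarrow>
                    \<exists>x\<in>X. {x, y} \<in> edges G \<and> w {x, y} = real t"
  shows "card Y \<le> k"
proof -
  have tr: "trans r" and irr: "irrefl r" and tot: "total_on (verts G) r"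
    and un: "(\<Union>i\<in>{1..k}. P i) = edges G"
    and queue: "\<And>i u v u' v'. i \<in> {1..k} \<Longrightarrow> {u, v} \<in> P i \<Longrightarrow> {u', v'} \<in> P i \<Longrightarrow>
       w {u, v} > w {u', v'} \<Longrightarrow> (u, v) \<in> r \<Longrightarrow> (u', v) \<in> r \<Longrightarrow> (v, v') \<in> r \<Longrightarrow> False"
    using layout unfolding pq_layout_def strict_linear_order_on_def by blast+
  \<comment> \<open>The rank of \<open>y\<close> within \<open>Y\<close>, counted from 0.\<close>
  define p where "p y = card {z \<in> Y. (z, y) \<in> r}" for y
  have p_less: "p y < card Y" if "y \<in> Y" for y
    unfolding p_def using that irr fin
    by (intro psubset_card_mono) (auto simp: irrefl_def)
  have p_mono: "p y < p y'" if "y \<in> Y" "(y, y') \<in> r" for y y'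
    unfolding p_def
  proof (rule psubset_card_mono)
    show "finite {z \<in> Y. (z, y') \<in> r}" using fin by simp
    have "{z \<in> Y. (z, y) \<in> r} \<subseteq> {z \<in> Y. (z, y') \<in> r}"
      using that(2) tr by (auto dest: transD)
    moreover have "y \<in> {z \<in> Y. (z, y') \<in> r}" "y \<notin> {z \<in> Y. (z, y) \<in> r}"
      using that irr by (auto simp: irrefl_def)
    ultimately show "{z \<in> Y. (z, y) \<in> r} \<subset> {z \<in> Y. (z, y') \<in> r}" by blast
  qed
  \<comment> \<open>Reversing the ranks makes the chosen weights fall from \<open>card Y - 1\<close>
    at the first vertex of \<open>Y\<close> to 0 at the last.\<close>
  have "\<exists>x\<in>X. {x, y} \<in> edges G \<and> w {x, y} = real (card Y - Suc (p y))" if "y \<in> Y" for y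
    using p_less[OF that] by (intro weights[OF that]) simp
  then obtain x where x: "\<And>y. y \<in> Y \<Longrightarrow> x y \<in> X \<and> {x y, y} \<in> edges G
      \<and> w {x y, y} = real (card Y - Suc (p y))"
    by metis
  have "\<exists>i\<in>{1..k}. {x y, y} \<in> P i" if "y \<in> Y" for y
    using x[OF that] un by blast
  then obtain q where q: "\<And>y. y \<in> Y \<Longrightarrow> q y \<in> {1..k} \<and> {x y, y} \<in> P (q y)"
    by metis
  \<comment> \<open>All of \<open>X\<close> precedes \<open>Y\<close>, so \<open>x y\<close> and
    \<open>x y'\<close> both precede \<open>y\<close>. With \<open>y\<close> before
    \<open>y'\<close> and the heavier edge at \<open>y\<close>, this is exactly the forbidden
    pattern.\<close>
  have distinct: "q y \<noteq> q y'" if y: "y \<in> Y" "y' \<in> Y" "(y, y') \<in> r" for y y'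
  proof
    assume same: "q y = q y'"
    have "w {x y, y} > w {x y', y'}"
      using x y p_mono[OF y(1,3)] p_less[OF y(2)] by simp
    then show False
      using queue[of "q y" "x y" y "x y'" y'] q y same before x by metis
  qed
  have "inj_on q Y"
  proof (rule inj_onI, rule ccontr)
    fix y y' assume y: "y \<in> Y" "y' \<in> Y" "q y = q y'" "y \<noteq> y'"
    then have "(y, y') \<in> r \<or> (y', y) \<in> r"
      using tot Y_verts by (auto simp: total_on_def)
    then show False using distinct y by metis
  qed
  then have "card Y \<le> card {1..k}"
    using q by (intro card_inj_on_le) auto
  then show ?thesis by simp
qed

lemma ex_shift_mod_eq:
  fixes s j t :: nat
  assumes "j < s" "t < s"
  shows "\<exists>i<s. (i + j) mod s = t"
\<comment> \<open>The witness is \<open>t - j\<close> modulo \<open>s\<close>; adding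
  \<open>s\<close> first avoids truncated subtraction.\<close>
proof (intro exI conjI)
  show "(t + (s - j)) mod s < s" using assms by simp
  have "((t + (s - j)) mod s + j) mod s = (t + (s - j) + j) mod s"
    by (simp add: mod_add_left_eq)
  also have "\<dots> = t" using assms by simp
  finally show "((t + (s - j)) mod s + j) mod s = t" .
qed

text \<open>A weight is a function of the edge as a set; summing the indices of its ends gives
  \<open>i + j\<close> without having to tell the ends apart.\<close>

lemma min_le_queues_complete_bipartite:
  fixes m n :: nat
  defines "s \<equiv> min m n"
  defines "w \<equiv> \<lambda>e :: (nat + nat) set. real ((\<Sum>v\<in>e. case_sum id id v) mod s)"
  assumes layout: "pq_layout (complete_bipartite m n) w k r P"
    and sep: "separated r (left_class m) (right_class n)"
  shows "s \<le> k"
proof -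
  let ?G = "complete_bipartite m n"
  have w: "w {Inl i, Inr j} = real ((i + j) mod s)" for i j
    by (simp add: w_def)
  have edge: "{Inl i, Inr j} \<in> edges ?G" if "i < s" "j < s" for i j
    using that by (auto simp: complete_bipartite_def left_class_def right_class_def s_def)
  \<comment> \<open>Cutting both classes to \<open>s\<close> vertices leaves exactly as many later
    vertices as there are weights, whichever class is later.\<close>
  have sub: "left_class s \<subseteq> left_class m" "right_class s \<subseteq> right_class n"
    by (auto simp: left_class_def right_class_def s_def)
  then have verts: "left_class s \<subseteq> verts ?G" "right_class s \<subseteq> verts ?G"
    by (auto simp: complete_bipartite_def)
  have fin: "finite (left_class s)" "finite (right_class s)"
    by (simp_all add: left_class_def right_class_def)
  \<comment> \<open>The layout may put either class last, so the Latin square is needed both by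
    columns (fixed \<open>j\<close>) and by rows (fixed \<open>i\<close>).\<close>
  from sep consider
      "\<forall>a\<in>left_class m. \<forall>b\<in>right_class n. (a, b) \<in> r"
    | "\<forall>a\<in>left_class m. \<forall>b\<in>right_class n. (b, a) \<in> r"
    by (auto simp: separated_def)
  then show ?thesis
  proof cases
    case 1
    have weights: "\<exists>x\<in>left_class s. {x, y} \<in> edges ?G \<and> w {x, y} = real t"
      if y: "y \<in> right_class s" and t: "t < card (right_class s)" for y t
    proof -
      obtain j where j: "j < s" "y = Inr j" using y by (auto simp: right_class_def)
      then obtain i where "i < s" "(i + j) mod s = t"
        using ex_shift_mod_eq[of j s t] t by (auto simp: card_right_class)
      then show ?thesis
        using j edge w by (intro bexI[of _ "Inl i"]) (auto simp: left_class_def)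
    qed
    have "card (right_class s) \<le> k"
      using 1 sub
      by (intro card_later_class_le_queues[OF layout _ fin(2) verts(2) weights]) auto
    then show ?thesis by (simp add: card_right_class)
  next
    case 2
    have weights: "\<exists>x\<in>right_class s. {x, y} \<in> edges ?G \<and> w {x, y} = real t"
      if y: "y \<in> left_class s" and t: "t < card (left_class s)" for y t
    proof -
      obtain i where i: "i < s" "y = Inl i" using y by (auto simp: left_class_def)
      then obtain j where "j < s" "(j + i) mod s = t"
        using ex_shift_mod_eq[of i s t] t by (auto simp: card_left_class)
      then show ?thesis
        using i edge w
        by (intro bexI[of _ "Inr j"]) (auto simp: right_class_def insert_commute add.commute)
    qed
    have "card (left_class s) \<le> k"
      using 2 sub
      by (intro card_later_class_le_queues[OF layout _ fin(1) verts(1) weights]) auto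
    then show ?thesis by (simp add: card_left_class)
  qed
qed

theorem theorem3p2:
  fixes m n :: nat
  assumes "m > 0" and "n > 0"
  shows "bpqn (complete_bipartite m n) (left_class m) (right_class n) = min m n"
  unfolding bpqn_def
proof (rule Least_equality)
  have fin: "finite (left_class m)" "finite (right_class n)"
    by (simp_all add: left_class_def right_class_def)
  note bip = bipartition_complete_bipartite[of m n]
  show "\<forall>w. \<exists>r P. pq_layout (complete_bipartite m n) w (min m n) r P \<and>
      separated r (left_class m) (right_class n)"
  \<comment> \<open>There is one queue per vertex of the later class, so the smaller class is put
    last.\<close>
  proof (cases "m \<le> n")
    case True
    then show ?thesis
      using pq_layout_stars[OF bipartition_commute[OF bip] fin(2,1)]
      by (simp add: card_left_class separated_commute min_def)
  next
    case False
    then show ?thesis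
      using pq_layout_stars[OF bip fin] by (simp add: card_right_class min_def)
  qed
next
  fix k
  assume "\<forall>w. \<exists>r P. pq_layout (complete_bipartite m n) w k r P \<and>
      separated r (left_class m) (right_class n)"
  then show "min m n \<le> k"
    using min_le_queues_complete_bipartite by blast
qed

end
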